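(* Let $\langle b,c\rangle$ be the free group of rank $2$ on $b,c$, and for $i\in\mathbb Z$ let $b_i=c^{-i}bc^i$. For any integer $m$, each of the subgroups $$\langle b_m,b_{m+1},\ldots\rangle,\qquad \langle b_{m-1},b_{m-2},\ldots\rangle$$ is benign in $\langle b,c\rangle$.
   Context: A subgroup $H$ of a finitely generated group $G$ is called benign in $G$ if $G$ can be embedded in a finitely presented group $K$ with a finitely generated subgroup $L\le K$ such that $G\cap L=H$. The set $b_m,b_{m+1},\ldots$ consists of all $b_i$ with $i\ge m$, and $b_{m-1},b_{m-2},\ldots$ of all $b_i$ with $i\le m-1$. *)

theory Defs
  imports "HOL-Algebra.Generated_Groups" "HOL.Hull"
begin

section \<open>Free groups as groups of reduced words\<close>

text \<open>The letter \<open>(x, True)\<close> stands for the generator \<open>x\<close>, and \<open>(x, False)\<close> for its formal inverse.\<close>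

type_synonym 'x word = "('x \<times> bool) list"

definition inv_letter :: "'x \<times> bool \<Rightarrow> 'x \<times> bool" where
  "inv_letter l = (fst l, \<not> snd l)"

definition reduced_word :: "'x word \<Rightarrow> bool" where
  "reduced_word w \<longleftrightarrow> successively (\<lambda>k l. l \<noteq> inv_letter k) w"

fun cancel_Cons :: "'x \<times> bool \<Rightarrow> 'x word \<Rightarrow> 'x word" where
  "cancel_Cons l [] = [l]"
| "cancel_Cons l (k # w) = (if k = inv_letter l then w else l # k # w)"

text \<open>The reduced word freely equivalent to a given word.\<close>

definition reduce_word :: "'x word \<Rightarrow> 'x word" where
  "reduce_word w = foldr cancel_Cons w []"

definition free_group :: "'x set \<Rightarrow> 'x word monoid" where
  "free_group X =
     \<lparr> carrier = {w. fst ` set w \<subseteq> X \<and> reduced_word w},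
       monoid.mult = (\<lambda>u v. reduce_word (u @ v)),
       one = [] \<rparr>"

text \<open>\<open>G\<close> is the free group on its subset \<open>S\<close>.\<close>

definition free_on :: "('a, 'm) monoid_scheme \<Rightarrow> 'a set \<Rightarrow> bool" where
  "free_on G S \<longleftrightarrow> group G \<and> S \<subseteq> carrier G \<and>
     (\<exists>h \<in> iso (free_group S) G. \<forall>x\<in>S. h [(x, True)] = x)"

lemma inv_letter_inv_letter [simp]: "inv_letter (inv_letter l) = l"
  by (simp add: inv_letter_def)

lemma fst_inv_letter [simp]: "fst (inv_letter l) = fst l"
  by (simp add: inv_letter_def)

lemma inv_letter_neq [simp]: "inv_letter l \<noteq> l" "l \<noteq> inv_letter l"
  by (cases l; simp add: inv_letter_def)+

lemma reduced_word_Nil [simp]: "reduced_word []"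
  by (simp add: reduced_word_def)

lemma reduced_cancel_Cons: "reduced_word w \<Longrightarrow> reduced_word (cancel_Cons l w)"
  by (cases w rule: remdups_adj.cases) (auto simp: reduced_word_def)

lemma cancel_Cons_inv:
  "reduced_word w \<Longrightarrow> cancel_Cons l (cancel_Cons (inv_letter l) w) = w"
  by (cases w rule: remdups_adj.cases) (auto simp: reduced_word_def)

lemma reduced_foldr_cancel: "reduced_word w \<Longrightarrow> reduced_word (foldr cancel_Cons u w)"
  by (induction u) (auto intro: reduced_cancel_Cons)

lemma reduced_reduce_word [simp]: "reduced_word (reduce_word w)"
  by (simp add: reduce_word_def reduced_foldr_cancel)

lemma reduce_word_reduced [simp]: "reduced_word w \<Longrightarrow> reduce_word w = w"
proof (induction w)
  case Nil
  then show ?case by (simp add: reduce_word_def)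
next
  case (Cons l w)
  then have "reduced_word w"
    by (cases w) (auto simp: reduced_word_def)
  with Cons show ?case
    by (cases w) (auto simp: reduce_word_def reduced_word_def)
qed

lemma foldr_cancel_cancel_Cons:
  assumes "reduced_word w"
  shows "foldr cancel_Cons (cancel_Cons l u) w = cancel_Cons l (foldr cancel_Cons u w)"
proof (cases u)
  case Nil
  then show ?thesis by simp
next
  case (Cons k v)
  then show ?thesis
    using cancel_Cons_inv[OF reduced_foldr_cancel[OF assms], of l v] by auto
qed

lemma foldr_cancel_reduce_word:
  "reduced_word w \<Longrightarrow> foldr cancel_Cons (reduce_word u) w = foldr cancel_Cons u w"
  by (induction u) (auto simp: reduce_word_def foldr_cancel_cancel_Cons)

lemma reduce_word_append: "reduce_word (u @ v) = foldr cancel_Cons u (reduce_word v)"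
  by (simp add: reduce_word_def)

lemma set_cancel_Cons: "set (cancel_Cons l w) \<subseteq> insert l (set w)"
  by (cases w) auto

lemma set_reduce_word: "set (reduce_word w) \<subseteq> set w"
  by (induction w) (use set_cancel_Cons in \<open>fastforce simp: reduce_word_def\<close>)+

lemma reduce_word_inverse:
  "reduce_word (rev (map inv_letter w) @ w) = []"
proof (induction w)
  case Nil
  then show ?case by (simp add: reduce_word_def)
next
  case (Cons l w)
  have "cancel_Cons (inv_letter l) (cancel_Cons l (reduce_word w)) = reduce_word w"
    using cancel_Cons_inv[of "reduce_word w" "inv_letter l"] by simp
  with Cons show ?case by (simp add: reduce_word_def)
qed

lemma group_free_group: "group (free_group X)"
proof (rule groupI)
  fix u v assume "u \<in> carrier (free_group X)" "v \<in> carrier (free_group X)"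
  then show "u \<otimes>\<^bsub>free_group X\<^esub> v \<in> carrier (free_group X)"
    using set_reduce_word[of "u @ v"] by (fastforce simp: free_group_def)
next
  fix u v w :: "'a word"
  assume "w \<in> carrier (free_group X)"
  then have "reduced_word w" by (simp add: free_group_def)
  then have "foldr cancel_Cons (reduce_word (u @ v)) w = foldr cancel_Cons u (foldr cancel_Cons v w)"
    by (simp only: foldr_cancel_reduce_word foldr_append comp_def)
  with \<open>reduced_word w\<close>
  have "reduce_word (reduce_word (u @ v) @ w) = reduce_word (u @ reduce_word (v @ w))"
    by (simp add: reduce_word_append[of "reduce_word (u @ v)" w] reduce_word_append[of v w]
        reduce_word_append[of u "foldr cancel_Cons v w"] reduced_foldr_cancel)
  then show "u \<otimes>\<^bsub>free_group X\<^esub> v \<otimes>\<^bsub>free_group X\<^esub> w =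
             u \<otimes>\<^bsub>free_group X\<^esub> (v \<otimes>\<^bsub>free_group X\<^esub> w)"
    by (simp add: free_group_def)
next
  fix w assume w: "w \<in> carrier (free_group X)"
  let ?v = "reduce_word (rev (map inv_letter w))"
  have "?v \<in> carrier (free_group X)"
    using w set_reduce_word[of "rev (map inv_letter w)"] by (fastforce simp: free_group_def)
  moreover have "reduce_word (?v @ w) = []"
    using w reduce_word_inverse[of w]
    by (simp add: free_group_def reduce_word_append foldr_cancel_reduce_word)
  ultimately show "\<exists>v\<in>carrier (free_group X). v \<otimes>\<^bsub>free_group X\<^esub> w = \<one>\<^bsub>free_group X\<^esub>"
    by (intro bexI[of _ ?v]) (simp_all add: free_group_def)
qed (auto simp: free_group_def)


section \<open>Finitely generated and finitely presented groups\<close>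

definition finitely_generated :: "('a, 'm) monoid_scheme \<Rightarrow> bool" where
  "finitely_generated G \<longleftrightarrow> group G \<and>
     (\<exists>S. finite S \<and> S \<subseteq> carrier G \<and> generate G S = carrier G)"

definition normal_closure :: "('a, 'm) monoid_scheme \<Rightarrow> 'a set \<Rightarrow> 'a set" where
  "normal_closure G R = (\<lambda>N. N \<lhd> G) hull R"

definition presented_group :: "'x set \<Rightarrow> 'x word set \<Rightarrow> 'x word set monoid" where
  "presented_group X R = free_group X Mod normal_closure (free_group X) R"

text \<open>Taking the finitely many generator symbols among the natural numbers is no restriction.\<close>

definition finitely_presented :: "('a, 'm) monoid_scheme \<Rightarrow> bool" where
  "finitely_presented G \<longleftrightarrow> group G \<and>
     (\<exists>(X :: nat set) R. finite X \<and> finite R \<and> R \<subseteq> carrier (free_group X) \<and>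
        G \<cong> presented_group X R)"

lemma (in group) normal_closure_normal:
  assumes "R \<subseteq> carrier G"
  shows "normal_closure G R \<lhd> G"
proof (rule normal_invI)
  let ?A = "{N. N \<lhd> G \<and> R \<subseteq> N}"
  have G: "carrier G \<in> ?A"
    using assms normal_inv_iff subgroup_self by auto
  show "subgroup (normal_closure G R) G"
    unfolding normal_closure_def hull_def
    by (rule subgroups_Inter) (use G normal_imp_subgroup in auto)
  show "x \<otimes> h \<otimes> inv x \<in> normal_closure G R"
    if "x \<in> carrier G" "h \<in> normal_closure G R" for x h
    using that normal.inv_op_closed2 by (fastforce simp: normal_closure_def hull_def)
qed

lemma group_presented_group: "R \<subseteq> carrier (free_group X) \<Longrightarrow> group (presented_group X R)"
  unfolding presented_group_def
  using group.normal_closure_normal[OF group_free_group] normal.factorgroup_is_group by blast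


section \<open>Benign subgroups\<close>

text \<open>
  The embedding of \<open>G\<close> into \<open>K\<close> is an injective homomorphism \<open>\<phi>\<close>, so \<open>G \<inter> L = H\<close> is read inside
  \<open>K\<close>. The type of \<open>K\<close> is that of the groups \<open>presented_group X R\<close> with \<open>X\<close> a set of natural
  numbers; up to isomorphism these include all finitely presented groups, and lemma \<open>benignI\<close>
  confirms that \<open>K\<close> may equally be taken of any other type.
\<close>

definition benign :: "'a set \<Rightarrow> ('a, 'm) monoid_scheme \<Rightarrow> bool" where
  "benign H G \<longleftrightarrow> finitely_generated G \<and> subgroup H G \<and>
     (\<exists>(K :: nat word set monoid) \<phi> L.
        finitely_presented K \<and> \<phi> \<in> mon G K \<and>
        subgroup L K \<and> finitely_generated (K\<lparr>carrier := L\<rparr>) \<and>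
        \<phi> ` carrier G \<inter> L = \<phi> ` H)"

lemma finitely_generated_subgroup_iff:
  assumes "group K" "subgroup L K"
  shows "finitely_generated (K\<lparr>carrier := L\<rparr>) \<longleftrightarrow>
           (\<exists>S. finite S \<and> S \<subseteq> carrier K \<and> generate K S = L)"
proof -
  interpret group K by fact
  have "group (K\<lparr>carrier := L\<rparr>)"
    using assms subgroup.subgroup_is_group by blast
  moreover have "S \<subseteq> L" if "generate K S = L" for S
    using that generate.incl by fast
  moreover have "generate (K\<lparr>carrier := L\<rparr>) S = generate K S" if "S \<subseteq> L" for S
    using generate_consistent[OF that assms(2)] .
  moreover have "L \<subseteq> carrier K"
    using subgroup.subset[OF assms(2)] .
  ultimately have "(\<exists>S. finite S \<and> S \<subseteq> L \<and> generate (K\<lparr>carrier := L\<rparr>) S = L) \<longleftrightarrow>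
      (\<exists>S. finite S \<and> S \<subseteq> carrier K \<and> generate K S = L)"
    by (intro ex_cong1) blast
  with \<open>group (K\<lparr>carrier := L\<rparr>)\<close> show ?thesis
    by (simp add: finitely_generated_def)
qed

lemma benignI:
  assumes "finitely_generated G" "subgroup H G" "finitely_presented K" "\<phi> \<in> mon G K"
    and L: "subgroup L K" "finitely_generated (K\<lparr>carrier := L\<rparr>)"
    and int: "\<phi> ` carrier G \<inter> L = \<phi> ` H"
  shows "benign H G"
proof -
  from \<open>finitely_presented K\<close> obtain X :: "nat set" and R \<theta>
    where X: "finite X" "finite R" "R \<subseteq> carrier (free_group X)"
      and \<theta>: "\<theta> \<in> iso K (presented_group X R)" and K: "group K"
    by (auto simp: finitely_presented_def is_iso_def)
  let ?P = "presented_group X R"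
  have P: "group ?P"
    using X group_presented_group by blast
  interpret \<theta>: group_hom K ?P \<theta>
    using K P \<theta> by (auto simp: group_hom_def group_hom_axioms_def iso_def)
  have inj: "inj_on \<theta> (carrier K)"
    using \<theta> by (simp add: iso_def bij_betw_def)
  have "finitely_presented ?P"
    using X P iso_refl unfolding finitely_presented_def by blast
  moreover have "\<theta> \<circ> \<phi> \<in> mon G ?P"
  proof -
    have "\<phi> \<in> hom G K" "inj_on \<phi> (carrier G)" "\<phi> ` carrier G \<subseteq> carrier K"
      using \<open>\<phi> \<in> mon G K\<close> by (auto simp: mon_def hom_def)
    then show ?thesis
      using inj \<theta>.homh by (auto simp: mon_def intro: hom_compose comp_inj_on inj_on_subset)
  qed
  moreover have L': "subgroup (\<theta> ` L) ?P"
    using L(1) by (rule \<theta>.subgroup_img_is_subgroup)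
  moreover have "finitely_generated (?P\<lparr>carrier := \<theta> ` L\<rparr>)"
  proof -
    obtain S where S: "finite S" "S \<subseteq> carrier K" "generate K S = L"
      using L finitely_generated_subgroup_iff[OF K] by blast
    then have "generate ?P (\<theta> ` S) = \<theta> ` L"
      using \<theta>.generate_img by simp
    moreover have "\<theta> ` S \<subseteq> carrier ?P" "finite (\<theta> ` S)"
      using S by auto
    ultimately show ?thesis
      unfolding finitely_generated_subgroup_iff[OF P L'] by blast
  qed
  moreover have "(\<theta> \<circ> \<phi>) ` carrier G \<inter> \<theta> ` L = (\<theta> \<circ> \<phi>) ` H"
  proof -
    have "\<phi> ` carrier G \<subseteq> carrier K" "L \<subseteq> carrier K"
      using \<open>\<phi> \<in> mon G K\<close> subgroup.subset[OF L(1)] by (auto simp: mon_def hom_def)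
    then have "\<theta> ` (\<phi> ` carrier G) \<inter> \<theta> ` L = \<theta> ` (\<phi> ` carrier G \<inter> L)"
      using inj_on_image_Int[OF inj] by simp
    with int show ?thesis by (simp add: image_comp)
  qed
  ultimately show ?thesis
    using assms(1,2) unfolding benign_def by blast
qed


section \<open>The conjugates of \<open>b\<close> by powers of \<open>c\<close>\<close>

definition conj_pow :: "('a, 'm) monoid_scheme \<Rightarrow> 'a \<Rightarrow> 'a \<Rightarrow> int \<Rightarrow> 'a" where
  "conj_pow G b c i = c [^]\<^bsub>G\<^esub> (- i) \<otimes>\<^bsub>G\<^esub> b \<otimes>\<^bsub>G\<^esub> c [^]\<^bsub>G\<^esub> i"

end

theory Submission
  imports Defs "HOL-Algebra.Group_Action"
begin

text \<open>
  Write \<open>b\<^sub>i = c\<^sup>-\<^sup>i b c\<^sup>i\<close>. Replacing the free generators \<open>b, c\<close> by \<open>b\<^sub>m, c\<close> or by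
  \<open>b\<^sub>m\<^sub>-\<^sub>1, c\<inverse>\<close> turns both subgroups into \<open>H = \<langle>b\<^sub>i | i \<ge> 0\<rangle>\<close>, so only \<open>H\<close> has to be treated.

  Every nonnegative integer arises from \<open>0\<close> by the maps \<open>i \<mapsto> 2i\<close> and \<open>i \<mapsto> 2i + 1\<close>, and both maps
  take negative integers to negative ones. Two stable letters realise
  the maps on indices. Let
  \<open>K = \<langle>\<beta>, \<gamma>, \<sigma>, \<delta> | \<sigma>\<beta> = \<beta>\<sigma>, \<delta>\<beta> = \<beta>\<delta>, \<sigma>\<gamma> = \<gamma>\<^sup>2\<sigma>, \<delta>\<gamma> = \<gamma>\<^sup>2\<delta>\<rangle>\<close>
  and map \<open>b, c\<close> to \<open>\<beta>, \<gamma>\<close>. In \<open>K\<close>, conjugation by \<open>\<sigma>\<close> takes \<open>b\<^sub>i\<close> to \<open>b\<^sub>2\<^sub>i\<close> and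
  conjugation by \<open>\<gamma>\<inverse>\<delta>\<close> takes it to \<open>b\<^sub>2\<^sub>i\<^sub>+\<^sub>1\<close>. Hence the finitely generated subgroup
  \<open>L = \<langle>\<beta>, \<sigma>, \<gamma>\<inverse>\<delta>\<rangle>\<close> contains the image of \<open>H\<close> (\<open>half_line_in_subgroup\<close>).

  It remains to see that the free group embeds in \<open>K\<close> and meets \<open>L\<close> in no more than \<open>H\<close>. The group \<open>K\<close> is
  a multiple HNN extension of the free group, but instead of a normal form theorem a single action of
  \<open>K\<close> suffices. It is an action on the reduced words whose letters are points of a grid: \<open>\<beta>\<close> multiplies
  from the left by the origin, and the other three generators relabel the letters by permutations of
  the grid, \<open>\<gamma>\<close> by a translation and \<open>\<sigma>, \<delta>\<close> by two kinds of dilation. Then \<open>b\<^sub>i\<close> multiplies by the grid point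
  \<open>(2i, 0)\<close>, and \<open>L\<close> preserves the set of words over a half plane that contains these points exactly
  when \<open>i \<ge> 0\<close> (\<open>half_line_group_preserves_half_plane\<close>). Every element of the free group is a product
  of a reduced word in the \<open>b\<^sub>i\<close> and a power of \<open>c\<close>. Such an element takes the empty word to the word
  in question (\<open>\<psi>_eval_word_Nil\<close>), and the power of \<open>c\<close> shows in the translation of a one-letter word.
  So the action detects both whether the element is trivial and whether it lies in \<open>H\<close>
  (\<open>normal_form_in_half_line_group\<close>).
\<close>

section \<open>Homomorphisms out of free and presented groups\<close>

definition eval_letter :: "('a, 'm) monoid_scheme \<Rightarrow> ('x \<Rightarrow> 'a) \<Rightarrow> 'x \<times> bool \<Rightarrow> 'a" where
  "eval_letter G f l = (if snd l then f (fst l) else inv\<^bsub>G\<^esub> f (fst l))"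

definition eval_word :: "('a, 'm) monoid_scheme \<Rightarrow> ('x \<Rightarrow> 'a) \<Rightarrow> 'x word \<Rightarrow> 'a" where
  "eval_word G f w = foldr (\<lambda>l g. eval_letter G f l \<otimes>\<^bsub>G\<^esub> g) w \<one>\<^bsub>G\<^esub>"

lemma eval_word_simps [simp]:
  "eval_word G f [] = \<one>\<^bsub>G\<^esub>"
  "eval_word G f (l # w) = eval_letter G f l \<otimes>\<^bsub>G\<^esub> eval_word G f w"
  by (simp_all add: eval_word_def)

lemma eval_letter_True_False [simp]:
  "eval_letter G f (x, True) = f x"
  "eval_letter G f (x, False) = inv\<^bsub>G\<^esub> f x"
  by (simp_all add: eval_letter_def)

lemma carrier_free_group: "w \<in> carrier (free_group X) \<longleftrightarrow> fst ` set w \<subseteq> X \<and> reduced_word w"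
  by (simp add: free_group_def)

lemma mult_free_group: "u \<otimes>\<^bsub>free_group X\<^esub> v = reduce_word (u @ v)"
  by (simp add: free_group_def)

lemma one_free_group: "\<one>\<^bsub>free_group X\<^esub> = []"
  by (simp add: free_group_def)

lemma generator_in_free_group [simp]: "[(x, e)] \<in> carrier (free_group X) \<longleftrightarrow> x \<in> X"
  by (simp add: free_group_def reduced_word_def)

lemma reduced_word_ConsD: "reduced_word (l # w) \<Longrightarrow> reduced_word w"
  by (cases w) (auto simp: reduced_word_def)

lemma cancel_Cons_reduced: "reduced_word (l # w) \<Longrightarrow> cancel_Cons l w = l # w"
  by (cases w) (auto simp: reduced_word_def)

lemma inv_generator_free_group:
  assumes "x \<in> X"
  shows "inv\<^bsub>free_group X\<^esub> [(x, True)] = [(x, False)]"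
proof (rule group.inv_equality[OF group_free_group])
  show "[(x, False)] \<otimes>\<^bsub>free_group X\<^esub> [(x, True)] = \<one>\<^bsub>free_group X\<^esub>"
    by (simp add: mult_free_group one_free_group reduce_word_def inv_letter_def)
qed (use assms in auto)

context group
begin

lemma eval_letter_closed:
  "f \<in> X \<rightarrow> carrier G \<Longrightarrow> fst l \<in> X \<Longrightarrow> eval_letter G f l \<in> carrier G"
  by (auto simp: eval_letter_def)

lemma eval_word_closed:
  "f \<in> X \<rightarrow> carrier G \<Longrightarrow> fst ` set w \<subseteq> X \<Longrightarrow> eval_word G f w \<in> carrier G"
  by (induction w) (auto intro: eval_letter_closed)

lemma eval_letter_inv_letter:
  "f \<in> X \<rightarrow> carrier G \<Longrightarrow> fst l \<in> X \<Longrightarrow>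
     eval_letter G f (inv_letter l) = inv (eval_letter G f l)"
  by (cases l) (auto simp: inv_letter_def eval_letter_def Pi_iff)

lemma eval_word_cancel_Cons:
  assumes f: "f \<in> X \<rightarrow> carrier G" and X: "fst l \<in> X" "fst ` set w \<subseteq> X"
  shows "eval_word G f (cancel_Cons l w) = eval_letter G f l \<otimes> eval_word G f w"
proof (cases w)
  case (Cons k v)
  then show ?thesis
    using X eval_letter_closed[OF f X(1)] eval_word_closed[OF f, of v]
    by (auto simp: eval_letter_inv_letter[OF f] m_assoc[symmetric])
qed simp

lemma eval_word_foldr_cancel:
  assumes f: "f \<in> X \<rightarrow> carrier G" and "fst ` set u \<subseteq> X" "fst ` set v \<subseteq> X"
  shows "eval_word G f (foldr cancel_Cons u v) = eval_word G f u \<otimes> eval_word G f v \<and>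
    fst ` set (foldr cancel_Cons u v) \<subseteq> X"
  using assms(2)
proof (induction u)
  case Nil
  then show ?case using eval_word_closed[OF f assms(3)] assms(3) by simp
next
  case (Cons l u)
  let ?w = "foldr cancel_Cons u v"
  have "fst ` set (cancel_Cons l ?w) \<subseteq> X"
    using set_cancel_Cons[of l ?w] Cons by auto
  then show ?case
    using Cons eval_word_cancel_Cons[OF f, of l ?w] eval_letter_closed[OF f, of l]
      eval_word_closed[OF f, of u] eval_word_closed[OF f assms(3)]
    by (simp add: m_assoc)
qed

lemma eval_word_hom:
  assumes f: "f \<in> X \<rightarrow> carrier G"
  shows "eval_word G f \<in> hom (free_group X) G"
proof (rule homI)
  fix u v assume uv: "u \<in> carrier (free_group X)" "v \<in> carrier (free_group X)"
  then have "u \<otimes>\<^bsub>free_group X\<^esub> v = foldr cancel_Cons u v"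
    by (simp add: mult_free_group carrier_free_group reduce_word_append)
  then show "eval_word G f (u \<otimes>\<^bsub>free_group X\<^esub> v) = eval_word G f u \<otimes> eval_word G f v"
    using eval_word_foldr_cancel[OF f] uv by (simp add: carrier_free_group)
qed (simp add: carrier_free_group eval_word_closed[OF f])

lemma hom_eq_eval_word:
  assumes h: "h \<in> hom (free_group X) G" and w: "w \<in> carrier (free_group X)"
  shows "h w = eval_word G (\<lambda>x. h [(x, True)]) w"
proof -
  interpret h: group_hom "free_group X" G h
    using h group_free_group is_group by (simp add: group_hom_def group_hom_axioms_def)
  from w show ?thesis
  proof (induction w)
    case Nil
    then show ?case using h.hom_one by (simp add: one_free_group)
  next
    case (Cons l w)
    then have w: "w \<in> carrier (free_group X)" and l: "fst l \<in> X" "[l] \<in> carrier (free_group X)"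
      by (auto simp: carrier_free_group reduced_word_def dest: reduced_word_ConsD[unfolded reduced_word_def])
    have "l # w = [l] \<otimes>\<^bsub>free_group X\<^esub> w"
      using Cons.prems w
      by (simp add: mult_free_group carrier_free_group reduce_word_append cancel_Cons_reduced)
    moreover have "h [l] = eval_letter G (\<lambda>x. h [(x, True)]) l"
    proof (cases l)
      case (Pair x e)
      then show ?thesis
        using l h.hom_inv[of "[(x, True)]"] inv_generator_free_group[of x X] by (cases e) auto
    qed
    ultimately show ?case
      using Cons.IH[OF w] h.hom_mult[OF l(2) w] by (metis eval_word_simps(2))
  qed
qed

end

lemma eval_word_in_generate:
  "fst ` set w \<subseteq> Y \<Longrightarrow> eval_word G f w \<in> generate G (f ` Y)"
  by (induction w)
    (auto simp: eval_letter_def intro: generate.one generate.eng generate.incl generate.inv)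

lemma generate_generators_free_group:
  "generate (free_group X) ((\<lambda>x. [(x, True)]) ` X) = carrier (free_group X)" (is "generate ?F ?S = _")
proof
  interpret F: group ?F by (rule group_free_group)
  show "generate ?F ?S \<subseteq> carrier ?F"
    by (rule F.generate_incl) auto
  show "carrier ?F \<subseteq> generate ?F ?S"
  proof
    fix w assume w: "w \<in> carrier ?F"
    have "(\<lambda>v. v) \<in> hom ?F ?F" by (simp add: hom_def)
    from F.hom_eq_eval_word[OF this w] have eq: "w = eval_word ?F (\<lambda>x. [(x, True)]) w" .
    have "eval_word ?F (\<lambda>x. [(x, True)]) w \<in> generate ?F ?S"
      using w by (intro eval_word_in_generate) (simp add: carrier_free_group)
    with eq show "w \<in> generate ?F ?S"
      by simp
  qed
qed

lemma free_on_imp_universal: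
  assumes free: "free_on F {b, c}" and "b \<noteq> c"
    and K: "group K" "\<beta> \<in> carrier K" "\<gamma> \<in> carrier K"
  shows "\<exists>\<phi> \<in> hom F K. \<phi> b = \<beta> \<and> \<phi> c = \<gamma>"
proof -
  from free obtain h where h: "h \<in> iso (free_group {b, c}) F" "h [(b, True)] = b" "h [(c, True)] = c"
    by (auto simp: free_on_def)
  let ?F = "free_group {b, c}" and ?f = "\<lambda>x. if x = b then \<beta> else \<gamma>"
  have f: "?f \<in> {b, c} \<rightarrow> carrier K" using K by auto
  have "inv_into (carrier ?F) h \<in> hom F ?F"
    using group.iso_set_sym[OF group_free_group h(1)] by (simp add: iso_def)
  then have "eval_word K ?f \<circ> inv_into (carrier ?F) h \<in> hom F K"
    using group.eval_word_hom[OF K(1) f] by (rule hom_compose)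
  moreover have "inv_into (carrier ?F) h b = [(b, True)]" "inv_into (carrier ?F) h c = [(c, True)]"
    using inv_into_f_eq[of h "carrier ?F" "[(b, True)]" b] inv_into_f_eq[of h "carrier ?F" "[(c, True)]" c] h
    by (simp_all add: iso_def bij_betw_def)
  ultimately show ?thesis
    using \<open>b \<noteq> c\<close> K by (intro bexI[of _ "eval_word K ?f \<circ> inv_into (carrier ?F) h"])
      (simp_all add: group.is_monoid)
qed

lemma free_on_imp_generate:
  assumes "free_on F S"
  shows "generate F S = carrier F"
proof -
  from assms obtain h where h: "h \<in> iso (free_group S) F" "\<And>x. x \<in> S \<Longrightarrow> h [(x, True)] = x"
    and F: "group F"
    by (auto simp: free_on_def)
  interpret h: group_hom "free_group S" F h
    using h F by (simp add: group_hom_def group_hom_axioms_def group_free_group iso_def)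
  have "(\<lambda>x. h [(x, True)]) ` S = S"
    using h(2) by simp
  moreover have "(\<lambda>x. [(x, True)]) ` S \<subseteq> carrier (free_group S)"
    by auto
  ultimately have "generate F S = h ` generate (free_group S) ((\<lambda>x. [(x, True)]) ` S)"
    using h.generate_img[of "(\<lambda>x. [(x, True)]) ` S"] by (simp only: image_image)
  also have "\<dots> = carrier F"
    using h(1) by (simp add: generate_generators_free_group iso_def bij_betw_def)
  finally show ?thesis .
qed

text \<open>
  Von Dyck's theorem for finitely many defining equations \<open>u = v\<close>: a quotient of the free group by
  the elements \<open>u v\<inverse>\<close> satisfies the equations and maps to every group \<open>Q\<close> in which they hold.
  Equations between words are easier to verify in a group of permutations than relators are, because
  no inverse permutation has to be computed.
\<close>

lemma presented_group_of_equations: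
  fixes X :: "nat set" and E :: "(nat word \<times> nat word) set"
    and Q :: "('a, 'm) monoid_scheme"
  assumes fin: "finite X" "finite E" and E: "E \<subseteq> carrier (free_group X) \<times> carrier (free_group X)"
    and Q: "group Q" and f: "f \<in> X \<rightarrow> carrier Q"
    and eq: "\<And>u v. (u, v) \<in> E \<Longrightarrow> eval_word Q f u = eval_word Q f v"
  obtains K :: "nat word set monoid" and g \<psi>
  where "finitely_presented K" "g \<in> X \<rightarrow> carrier K"
    "\<And>u v. (u, v) \<in> E \<Longrightarrow> eval_word K g u = eval_word K g v"
    "\<psi> \<in> hom K Q" "\<And>x. x \<in> X \<Longrightarrow> \<psi> (g x) = f x"
proof -
  let ?F = "free_group X"
  interpret F: group ?F by (rule group_free_group)
  interpret Q: group Q by (rule Q)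
  define R where "R = (\<lambda>(u, v). u \<otimes>\<^bsub>?F\<^esub> inv\<^bsub>?F\<^esub> v) ` E"
  have R: "finite R" "R \<subseteq> carrier ?F"
    using fin E by (auto simp: R_def)
  define N where "N = normal_closure ?F R"
  have N: "N \<lhd> ?F"
    unfolding N_def by (rule F.normal_closure_normal[OF R(2)])
  interpret N: normal N ?F by (rule N)
  have RN: "R \<subseteq> N"
    unfolding N_def normal_closure_def by (rule hull_subset)
  define K where "K = presented_group X R"
  have K_eq: "K = ?F Mod N"
    by (simp add: K_def presented_group_def N_def)
  interpret K: group K
    unfolding K_def by (rule group_presented_group[OF R(2)])
  have fp: "finitely_presented K"
    unfolding finitely_presented_def using fin R K.is_group iso_refl[of K] K_def by blast
  define \<pi> where "\<pi> w = N #>\<^bsub>?F\<^esub> w" for w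
  have \<pi>: "\<pi> \<in> hom ?F K"
    unfolding \<pi>_def K_eq using N.r_coset_hom_Mod by simp
  interpret \<pi>: group_hom ?F K \<pi>
    using \<pi> by (simp add: group_hom_def group_hom_axioms_def F.is_group K.is_group)
  have eqK: "eval_word K (\<lambda>x. \<pi> [(x, True)]) u = eval_word K (\<lambda>x. \<pi> [(x, True)]) v"
    if uv: "(u, v) \<in> E" for u v
  proof -
    have c: "u \<in> carrier ?F" "v \<in> carrier ?F" using E uv by auto
    have "u \<otimes>\<^bsub>?F\<^esub> inv\<^bsub>?F\<^esub> v \<in> N"
      using uv RN by (auto simp: R_def)
    then have "\<pi> (u \<otimes>\<^bsub>?F\<^esub> inv\<^bsub>?F\<^esub> v) = \<one>\<^bsub>K\<^esub>"
      unfolding \<pi>_def K_eq by (simp add: FactGroup_def N.rcos_const)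
    then have "\<pi> u = \<pi> v"
      using c by (simp add: K.inv_solve_right')
    then show ?thesis
      using K.hom_eq_eval_word[OF \<pi>] c by simp
  qed
  interpret f: group_hom ?F Q "eval_word Q f"
    using Q.eval_word_hom[OF f] by (simp add: group_hom_def group_hom_axioms_def F.is_group Q)
  have "R \<subseteq> kernel ?F Q (eval_word Q f)"
    using E eq by (fastforce simp: R_def kernel_def)
  then have "N \<subseteq> kernel ?F Q (eval_word Q f)"
    unfolding N_def normal_closure_def by (rule hull_minimal) (rule f.normal_kernel)
  then obtain \<psi> where \<psi>: "\<psi> \<in> hom K Q" "\<And>w. w \<in> carrier ?F \<Longrightarrow> \<psi> (\<pi> w) = eval_word Q f w"
    using f.FactGroup_universal_kernel[OF N] unfolding K_eq \<pi>_def by metis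
  show ?thesis
  proof (rule that[OF fp _ eqK \<psi>(1)])
    show "(\<lambda>x. \<pi> [(x, True)]) \<in> X \<rightarrow> carrier K" by auto
    show "\<psi> (\<pi> [(x, True)]) = f x" if "x \<in> X" for x
      using \<psi>(2)[of "[(x, True)]"] that f by (auto simp: Pi_iff)
  qed
qed

context group
begin

text \<open>
  The free group on the index set maps onto the generated subgroup, so the word can be taken reduced;
  reducedness is what lets the word be read off from its action later.
\<close>

lemma generate_range_eval_word:
  assumes f: "range f \<subseteq> carrier G" and g: "g \<in> generate G (range f)"
  obtains w where "reduced_word w" "g = eval_word G f w"
proof -
  have f': "f \<in> UNIV \<rightarrow> carrier G" using f by auto
  interpret f: group_hom "free_group UNIV" G "eval_word G f"
    using eval_word_hom[OF f'] by (simp add: group_hom_def group_hom_axioms_def group_free_group is_group)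
  have "(\<lambda>x. eval_word G f [(x, True)]) ` UNIV = range f"
    using f by (intro image_cong) (auto simp: image_subset_iff)
  moreover have "range (\<lambda>x. [(x, True)]) \<subseteq> carrier (free_group UNIV)"
    by auto
  ultimately have "generate G (range f) = eval_word G f ` carrier (free_group UNIV)"
    using f.generate_img[of "range (\<lambda>x. [(x, True)])"]
    by (simp only: image_image generate_generators_free_group)
  with g that show ?thesis by (auto simp: carrier_free_group)
qed

end


section \<open>Conjugates of one generator by powers of the other\<close>

context group
begin

lemma conj_pow_closed [simp]:
  "b \<in> carrier G \<Longrightarrow> c \<in> carrier G \<Longrightarrow> conj_pow G b c i \<in> carrier G"
  by (simp add: conj_pow_def)

lemma conj_pow_0 [simp]: "b \<in> carrier G \<Longrightarrow> conj_pow G b c 0 = b"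
  by (simp add: conj_pow_def)

lemma conj_pow_conj_pow:
  assumes "b \<in> carrier G" "c \<in> carrier G"
  shows "conj_pow G (conj_pow G b c i) c j = conj_pow G b c (i + j)"
proof -
  have "c [^] (- (i + j)) = c [^] (- j) \<otimes> c [^] (- i)"
  proof -
    have "- (i + j) = - j + - i" by simp
    then show ?thesis using assms by (simp only: int_pow_mult)
  qed
  then show ?thesis
    using assms by (simp add: conj_pow_def m_assoc int_pow_mult)
qed

lemma conj_pow_int_pow:
  assumes "b \<in> carrier G" "c \<in> carrier G"
  shows "conj_pow G b (c [^] (k::int)) i = conj_pow G b c (k * i)"
  using assms by (simp add: conj_pow_def int_pow_pow)

lemma conj_pow_inv:
  assumes "b \<in> carrier G" "c \<in> carrier G"
  shows "conj_pow G b (inv c) i = conj_pow G b c (- i)"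
  using conj_pow_int_pow[OF assms, of "-1" i] assms by (simp add: int_pow_neg)

lemma conjugation_hom:
  assumes "s \<in> carrier G"
  shows "(\<lambda>x. s \<otimes> x \<otimes> inv s) \<in> hom G G"
  using assms by (intro homI) (auto simp: m_assoc inv_solve_left)

text \<open>
  The conjugates of \<open>b\<close> by powers of \<open>c\<close> generate a subgroup that powers of \<open>c\<close> normalise, so in any
  product of \<open>b\<close>, \<open>c\<close> and their inverses all powers of \<open>c\<close> can be collected at the right end.
\<close>

lemma generate_pair_normal_form:
  assumes bc: "b \<in> carrier G" "c \<in> carrier G" and g: "g \<in> generate G {b, c}"
  obtains h k where "h \<in> generate G (range (conj_pow G b c))" "g = h \<otimes> c [^] (k :: int)"
proof -
  let ?B = "generate G (range (conj_pow G b c))"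
  have B: "subgroup ?B G"
    by (rule generate_is_subgroup) (use bc in auto)
  note Bc = subgroup.mem_carrier[OF B]
  have conj: "c [^] k \<otimes> h \<otimes> inv (c [^] k) \<in> ?B" if "h \<in> ?B" for h and k :: int
  proof -
    interpret conj: group_hom G G "\<lambda>x. c [^] k \<otimes> x \<otimes> inv (c [^] k)"
      using conjugation_hom[of "c [^] k"] bc
      by (simp add: group_hom_def group_hom_axioms_def is_group)
    have "c [^] k \<otimes> conj_pow G b c i \<otimes> inv (c [^] k) = conj_pow G b c (i - k)" for i
      using conj_pow_conj_pow[OF bc, of i "- k"] bc by (simp add: conj_pow_def int_pow_neg)
    then have "(\<lambda>x. c [^] k \<otimes> x \<otimes> inv (c [^] k)) ` range (conj_pow G b c) \<subseteq> range (conj_pow G b c)"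
      by auto
    then have "generate G ((\<lambda>x. c [^] k \<otimes> x \<otimes> inv (c [^] k)) ` range (conj_pow G b c)) \<subseteq> ?B"
      by (rule mono_generate)
    moreover have "range (conj_pow G b c) \<subseteq> carrier G"
      using bc by auto
    ultimately show ?thesis
      using conj.generate_img that by blast
  qed
  have "\<exists>h k. h \<in> ?B \<and> g = h \<otimes> c [^] (k :: int)"
    using g
  proof (induction g rule: generate.induct)
    case one
    have "\<one> = \<one> \<otimes> c [^] (0 :: int)" by simp
    then show ?case using generate.one by blast
  next
    case (incl g)
    have "b = conj_pow G b c 0 \<otimes> c [^] (0 :: int)" "c = \<one> \<otimes> c [^] (1 :: int)"
      using bc by auto
    moreover have "conj_pow G b c 0 \<in> ?B"
      by (rule generate.incl) auto
    ultimately show ?case using incl generate.one by blast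
  next
    case (inv g)
    have "inv b = inv (conj_pow G b c 0) \<otimes> c [^] (0 :: int)" "inv c = \<one> \<otimes> c [^] (-1 :: int)"
      using bc by (auto simp: int_pow_neg)
    moreover have "inv (conj_pow G b c 0) \<in> ?B"
      by (rule generate.inv) auto
    ultimately show ?case using inv generate.one by blast
  next
    case (eng g1 g2)
    then obtain h1 k1 h2 k2 where
      h: "h1 \<in> ?B" "g1 = h1 \<otimes> c [^] (k1 :: int)" "h2 \<in> ?B" "g2 = h2 \<otimes> c [^] (k2 :: int)"
      by blast
    have "g1 \<otimes> g2 = (h1 \<otimes> (c [^] k1 \<otimes> h2 \<otimes> inv (c [^] k1))) \<otimes> (c [^] k1 \<otimes> c [^] k2)"
      using bc h Bc by (simp add: m_assoc inv_solve_left)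
    then have "g1 \<otimes> g2 = (h1 \<otimes> (c [^] k1 \<otimes> h2 \<otimes> inv (c [^] k1))) \<otimes> c [^] (k1 + k2)"
      using bc by (simp only: int_pow_mult)
    moreover have "h1 \<otimes> (c [^] k1 \<otimes> h2 \<otimes> inv (c [^] k1)) \<in> ?B"
      using h conj by (blast intro: generate.eng)
    ultimately show ?case by blast
  qed
  with that show ?thesis by blast
qed

end

lemma (in group_hom) hom_conj_pow:
  assumes "b \<in> carrier G" "c \<in> carrier G"
  shows "h (conj_pow G b c i) = conj_pow H (h b) (h c) i"
  using assms by (simp add: conj_pow_def hom_int_pow)

text \<open>
  Conjugation by \<open>s\<close> is an endomorphism with \<open>b \<mapsto> b\<close> and \<open>c \<mapsto> c\<^sup>2\<close>, so it doubles the index \<open>i\<close> in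
  \<open>c\<^sup>-\<^sup>i b c\<^sup>i\<close>.
\<close>

lemma (in group) conj_pow_double:
  assumes c: "s \<in> carrier G" "b \<in> carrier G" "c \<in> carrier G"
    and sb: "s \<otimes> b = b \<otimes> s" and sc: "s \<otimes> c = c \<otimes> c \<otimes> s"
  shows "s \<otimes> conj_pow G b c i \<otimes> inv s = conj_pow G b c (2 * i)"
proof -
  interpret conj: group_hom G G "\<lambda>x. s \<otimes> x \<otimes> inv s"
    using conjugation_hom[OF c(1)] by (simp add: group_hom_def group_hom_axioms_def is_group)
  have "s \<otimes> b \<otimes> inv s = b" "s \<otimes> c \<otimes> inv s = c [^] (2 :: int)"
    using c sb sc int_pow_mult[of c 1 1] by (simp_all add: m_assoc)
  then show ?thesis
    using conj.hom_conj_pow[OF c(2,3), of i] conj_pow_int_pow[OF c(2,3), of 2 i] by simp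
qed

text \<open>
  Conjugation by \<open>s\<close> takes index \<open>i\<close> to \<open>2i\<close>, and conjugation by \<open>c\<inverse> d\<close> takes it to \<open>2i + 1\<close>. Binary
  expansion thus reaches every index \<open>i \<ge> 0\<close> from \<open>0\<close>.
\<close>

lemma (in group) half_line_in_subgroup:
  fixes i :: int
  assumes L: "subgroup L G" and mem: "b \<in> L" "s \<in> L" "inv c \<otimes> d \<in> L"
    and c: "c \<in> carrier G" and d: "d \<in> carrier G"
    and s: "s \<otimes> b = b \<otimes> s" "s \<otimes> c = c \<otimes> c \<otimes> s"
    and d': "d \<otimes> b = b \<otimes> d" "d \<otimes> c = c \<otimes> c \<otimes> d"
    and i: "0 \<le> i"
  shows "conj_pow G b c i \<in> L"
proof -
  note Lc = subgroup.mem_carrier[OF L]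
  have "conj_pow G b c (int n) \<in> L" for n
  proof (induction n rule: less_induct)
    case (less n)
    let ?x = "conj_pow G b c (int (n div 2))"
    show ?case
    proof (cases "n = 0")
      case True
      then show ?thesis using Lc[OF mem(1)] mem by simp
    next
      case False
      then have x: "?x \<in> L" using less by simp
      have "s \<otimes> ?x \<otimes> inv s \<in> L" "(inv c \<otimes> d) \<otimes> ?x \<otimes> inv (inv c \<otimes> d) \<in> L"
        using x mem subgroup.m_closed[OF L] subgroup.m_inv_closed[OF L] by auto
      moreover have "s \<otimes> ?x \<otimes> inv s = conj_pow G b c (2 * int (n div 2))"
        using conj_pow_double Lc mem c s by simp
      moreover have "(inv c \<otimes> d) \<otimes> ?x \<otimes> inv (inv c \<otimes> d) = conj_pow G b c (2 * int (n div 2) + 1)"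
      proof -
        have "(inv c \<otimes> d) \<otimes> ?x \<otimes> inv (inv c \<otimes> d) = inv c \<otimes> (d \<otimes> ?x \<otimes> inv d) \<otimes> c"
          using c d Lc[OF x] by (simp add: inv_mult_group m_assoc)
        also have "\<dots> = conj_pow G (conj_pow G b c (2 * int (n div 2))) c 1"
          using conj_pow_double[of d b c] Lc mem c d d' by (simp add: conj_pow_def int_pow_neg)
        also have "\<dots> = conj_pow G b c (2 * int (n div 2) + 1)"
          using conj_pow_conj_pow Lc mem c by blast
        finally show ?thesis .
      qed
      moreover have "int n = 2 * int (n div 2) \<or> int n = 2 * int (n div 2) + 1"
        by presburger
      ultimately show ?thesis by metis
    qed
  qed
  from this[of "nat i"] i show ?thesis by simp
qed

section \<open>Two kinds of bijections of the set of reduced words\<close>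

definition relabel :: "('x \<Rightarrow> 'y) \<Rightarrow> 'x word \<Rightarrow> 'y word" where
  "relabel f = map (apfst f)"

abbreviation reduced_words :: "'x word set" where
  "reduced_words \<equiv> carrier (free_group UNIV)"

lemma relabel_simps [simp]:
  "relabel f [] = []"
  "relabel f (l # w) = (f (fst l), snd l) # relabel f w"
  by (simp_all add: relabel_def apfst_def map_prod_def split_beta)

lemma relabel_comp: "relabel f (relabel g w) = relabel (\<lambda>x. f (g x)) w"
  by (induction w) auto

lemma relabel_ident: "relabel (\<lambda>x. x) w = w"
  by (induction w) auto

lemma fst_set_relabel: "fst ` set (relabel f w) = f ` fst ` set w"
  by (induction w) auto

lemma reduced_word_relabel:
  assumes "inj f"
  shows "reduced_word (relabel f w) \<longleftrightarrow> reduced_word w"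
  by (induction w rule: induct_list012)
    (use assms in \<open>auto simp: reduced_word_def inv_letter_def inj_eq prod_eq_iff\<close>)

lemma relabel_in_free_group:
  "inj f \<Longrightarrow> relabel f w \<in> carrier (free_group Y) \<longleftrightarrow> w \<in> carrier (free_group (f -` Y))"
  by (auto simp: carrier_free_group reduced_word_relabel fst_set_relabel)

lemma bij_betw_relabel:
  assumes "bij f"
  shows "bij_betw (relabel f) reduced_words reduced_words"
proof (rule bij_betwI[where g = "relabel (inv_into UNIV f)"])
  show "relabel f \<in> reduced_words \<rightarrow> reduced_words"
    using assms by (auto simp: relabel_in_free_group bij_def)
  show "relabel (inv_into UNIV f) \<in> reduced_words \<rightarrow> reduced_words"
    using bij_imp_bij_inv[OF assms] by (auto simp: relabel_in_free_group bij_def)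
qed (use assms in \<open>auto simp: relabel_comp bij_is_inj bij_is_surj surj_f_inv_f relabel_ident\<close>)

lemma relabel_cancel_Cons:
  "inj f \<Longrightarrow> relabel f (cancel_Cons l w) = cancel_Cons (f (fst l), snd l) (relabel f w)"
  by (cases w) (auto simp: inv_letter_def inj_eq prod_eq_iff)

lemma cancel_Cons_in_free_group:
  assumes "reduced_word w" "fst l \<in> Y"
  shows "cancel_Cons l w \<in> carrier (free_group Y) \<longleftrightarrow> w \<in> carrier (free_group Y)"
proof (cases w)
  case (Cons k v)
  with assms show ?thesis
    by (auto simp: carrier_free_group reduced_cancel_Cons dest: reduced_word_ConsD)
      (auto simp: reduced_word_def)
qed (use assms in \<open>auto simp: carrier_free_group reduced_word_def\<close>)

lemma bij_betw_cancel_Cons: "bij_betw (cancel_Cons l) reduced_words reduced_words"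
proof (rule bij_betwI[where g = "cancel_Cons (inv_letter l)"])
  show "cancel_Cons (inv_letter l) (cancel_Cons l w) = w" if "w \<in> reduced_words" for w
    using that cancel_Cons_inv[of w "inv_letter l"] by (simp add: carrier_free_group)
qed (auto simp: carrier_free_group reduced_cancel_Cons cancel_Cons_inv)

section \<open>Translation and dilations of a grid\<close>

type_synonym point = "int \<times> nat"

text \<open>
  A \<open>point\<close> is a column number together with a height. The points \<open>(2i, 0)\<close> stand for the conjugates
  \<open>c\<^sup>-\<^sup>i b c\<^sup>i\<close>; all other points serve to make the maps below bijective.
\<close>

definition shift :: "int \<Rightarrow> point \<Rightarrow> point" where
  "shift k p = (fst p + k, snd p)"

text \<open>
  A bijection \<open>S\<close> with \<open>S T\<^sup>2 = T\<^sup>4 S\<close> for the unit translation \<open>T\<close>, that is, a permutation realising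
  the endomorphism that doubles \<open>c\<close>. A translation \<open>T\<^sup>2\<close> has two columns as fundamental domain and \<open>T\<^sup>4\<close>
  has four, so two columns must be mapped onto four: an even column is spread over the three columns
  \<open>2n, 2n + 1, 2n + 2\<close> according to the height modulo 3, and the odd column after it goes to the
  remaining one. The columns \<open>0\<close> and \<open>-1\<close> contain fixed points, and \<open>S\<close> never moves a point across the
  boundary between the columns \<open>-2\<close> and \<open>-1\<close>.
\<close>

definition dilate :: "point \<Rightarrow> point" where
  "dilate p = (if even (fst p) then (2 * fst p + int (snd p mod 3), snd p div 3)
     else (2 * fst p + 1, snd p))"

text \<open>
  The conjugate of \<open>dilate\<close> by the unit translation. It has the same commutation relation with the
  translation by two and fixes the origin too, because \<open>dilate\<close> fixes \<open>(-1, 0)\<close> as well as \<open>(0, 0)\<close>.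
\<close>

definition dilate' :: "point \<Rightarrow> point" where
  "dilate' p = shift 1 (dilate (shift (- 1) p))"

lemma shift_shift [simp]: "shift k (shift l p) = shift (k + l) p"
  by (simp add: shift_def)

lemma shift_0 [simp]: "shift 0 p = p"
  by (simp add: shift_def)

lemma bij_shift: "bij (shift k)"
  by (rule o_bij[where g = "shift (- k)"]) auto

lemma bij_dilate: "bij dilate"
proof (rule o_bij)
  \<comment> \<open>The inverse: the column modulo 4 tells which of the two clauses produced the point.\<close>
  define g :: "point \<Rightarrow> point" where "g = (\<lambda>(n, i). if n mod 4 = 3 then (2 * (n div 4) + 1, i)
    else (2 * (n div 4), 3 * i + nat (n mod 4)))"
  have "g (dilate (n, i)) = (n, i)" for n i
  proof (cases "even n")
    case True
    then obtain k where n: "n = 2 * k" ..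
    have "(4 * k + int (i mod 3)) div 4 = k" "(4 * k + int (i mod 3)) mod 4 = int (i mod 3)"
      by (simp_all add: div_add1_eq zmod_int)
    moreover have "int (i mod 3) \<noteq> 3"
      by (metis mod_less_divisor nat_neq_iff of_nat_eq_iff of_nat_numeral zero_less_numeral)
    ultimately show ?thesis
      by (simp add: n g_def dilate_def)
  next
    case False
    then obtain k where n: "n = 2 * k + 1" by (rule oddE)
    have "(4 * k + 3) div 4 = k" "(4 * k + 3) mod 4 = 3" by simp_all
    then show ?thesis
      by (simp add: n g_def dilate_def algebra_simps)
  qed
  then show "g \<circ> dilate = id" by auto
  have "dilate (g (n, i)) = (n, i)" for n i
  proof (cases "n mod 4 = 3")
    case True
    then have "4 * (n div 4) + 3 = n" by presburger
    then show ?thesis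
      using True by (simp add: g_def dilate_def)
  next
    case False
    have "0 \<le> n mod 4" "n mod 4 < 4" by simp_all
    with False have "nat (n mod 4) < 3" by linarith
    then show ?thesis
      using False by (simp add: g_def dilate_def)
  qed
  then show "dilate \<circ> g = id" by auto
qed

lemma bij_dilate': "bij dilate'"
proof -
  have "dilate' = shift 1 \<circ> dilate \<circ> shift (- 1)"
    by (auto simp: dilate'_def)
  then show ?thesis
    using bij_shift bij_dilate by (metis bij_comp)
qed

lemma dilate_shift: "dilate (shift (- 2) p) = shift (- 2) (shift (- 2) (dilate p))"
  by (simp add: dilate_def shift_def)

lemma dilate'_shift: "dilate' (shift (- 2) p) = shift (- 2) (shift (- 2) (dilate' p))"
  using dilate_shift[of "shift (- 1) p"] by (simp add: dilate'_def)

lemma dilate_origin: "dilate (0, 0) = (0, 0)" "dilate' (0, 0) = (0, 0)"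
  by (simp_all add: dilate_def dilate'_def shift_def)

text \<open>
  The even columns in this set are those with nonnegative number. On even columns at height \<open>0\<close>, the map
  \<open>dilate\<close> doubles the column number, and \<open>dilate'\<close> followed by a translation by two doubles it and adds
  two; these are the maps \<open>i \<mapsto> 2i\<close> and \<open>i \<mapsto> 2i + 1\<close> in terms of half the column number. The column
  \<open>-1\<close> is included because the second of them takes \<open>(-1, 1)\<close> to the origin, so that a half plane with
  boundary column \<open>0\<close> would not be invariant.
\<close>

definition half_plane :: "point set" where
  "half_plane = {p. - 1 \<le> fst p}"

lemma dilate_half_plane: "dilate p \<in> half_plane \<longleftrightarrow> p \<in> half_plane"
proof -
  define r where "r = int (snd p mod 3)"
  have "0 \<le> r" "r < 3" by (simp_all add: r_def)
  then show ?thesis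
    unfolding half_plane_def dilate_def r_def[symmetric] by simp presburger
qed

lemma shift_dilate'_half_plane: "shift 2 (dilate' p) \<in> half_plane \<longleftrightarrow> p \<in> half_plane"
proof -
  define r where "r = int (snd p mod 3)"
  have "0 \<le> r" "r < 3" by (simp_all add: r_def)
  then show ?thesis
    unfolding half_plane_def dilate'_def dilate_def shift_def fst_conv snd_conv r_def[symmetric]
    by simp presburger
qed

lemma half_plane_relabel:
  assumes "bij f" "\<And>p. f p \<in> half_plane \<longleftrightarrow> p \<in> half_plane"
  shows "relabel f w \<in> carrier (free_group half_plane) \<longleftrightarrow> w \<in> carrier (free_group half_plane)"
proof -
  have "f -` half_plane = half_plane" using assms(2) by blast
  then show ?thesis using assms(1) by (simp add: relabel_in_free_group bij_is_inj)
qed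


section \<open>A finitely presented overgroup and its action\<close>

text \<open>
  The relations say that \<open>\<sigma>\<close> and \<open>\<delta>\<close> both act by conjugation as the endomorphism \<open>\<beta> \<mapsto> \<beta>\<close>,
  \<open>\<gamma> \<mapsto> \<gamma>\<^sup>2\<close> of the free group. The action \<open>\<psi>\<close> certifies that they do not force more than they should.
  The generator \<open>\<gamma>\<close> translates by \<open>-2\<close>, so that \<open>\<gamma>\<^sup>-\<^sup>i \<beta> \<gamma>\<^sup>i\<close> multiplies by the letter at column \<open>2i\<close>.
\<close>

locale dyadic_extension = group K for K (structure) +
  fixes \<beta> \<gamma> \<sigma> \<delta> and \<psi>
  assumes closed [simp]: "\<beta> \<in> carrier K" "\<gamma> \<in> carrier K" "\<sigma> \<in> carrier K" "\<delta> \<in> carrier K"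
    and rel_\<sigma>: "\<sigma> \<otimes> \<beta> = \<beta> \<otimes> \<sigma>" "\<sigma> \<otimes> \<gamma> = \<gamma> \<otimes> \<gamma> \<otimes> \<sigma>"
    and rel_\<delta>: "\<delta> \<otimes> \<beta> = \<beta> \<otimes> \<delta>" "\<delta> \<otimes> \<gamma> = \<gamma> \<otimes> \<gamma> \<otimes> \<delta>"
    and \<psi>_hom: "\<psi> \<in> hom K (BijGroup (reduced_words :: point word set))"
    and \<psi>_\<beta>: "w \<in> reduced_words \<Longrightarrow> \<psi> \<beta> w = cancel_Cons ((0, 0), True) w"
    and \<psi>_\<gamma>: "w \<in> reduced_words \<Longrightarrow> \<psi> \<gamma> w = relabel (shift (- 2)) w"
    and \<psi>_\<sigma>: "w \<in> reduced_words \<Longrightarrow> \<psi> \<sigma> w = relabel dilate w"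
    and \<psi>_\<delta>: "w \<in> reduced_words \<Longrightarrow> \<psi> \<delta> w = relabel dilate' w"

lemma BijGroup_mult_restrict:
  assumes "bij_betw f S S" "bij_betw g S S"
  shows "restrict f S \<otimes>\<^bsub>BijGroup S\<^esub> restrict g S = restrict (\<lambda>x. f (g x)) S"
proof -
  have "restrict f S \<in> Bij S" "restrict g S \<in> Bij S"
    using assms by (auto simp: Bij_def cong: bij_betw_cong)
  then show ?thesis
    using assms by (auto simp: BijGroup_def compose_def bij_betw_apply intro!: restrict_ext)
qed

text \<open>
  The group is presented by the four relations, and the action exists because the permutations
  satisfy them: relabelling by a map that fixes the origin commutes with multiplication by the origin,
  and the dilations have the right commutation relation with the translation.
\<close>

lemma dyadic_extension_exists:
  obtains K :: "nat word set monoid" and \<beta> \<gamma> \<sigma> \<delta> \<psi>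
  where "finitely_presented K" "dyadic_extension K \<beta> \<gamma> \<sigma> \<delta> \<psi>"
proof -
  let ?W = "reduced_words :: point word set"
  let ?Q = "BijGroup ?W"
  interpret Q: group ?Q by (rule group_BijGroup)
  \<comment> \<open>The generator symbols 0, 1, 2, 3 stand for \<open>\<beta>\<close>, \<open>\<gamma>\<close>, \<open>\<sigma>\<close>, \<open>\<delta>\<close>.\<close>
  define a :: "nat \<Rightarrow> point word \<Rightarrow> point word" where
    "a = (\<lambda>i. [cancel_Cons ((0, 0), True), relabel (shift (- 2)), relabel dilate, relabel dilate'] ! i)"
  define f where "f i = restrict (a i) ?W" for i
  let ?b = "(0, True) :: nat \<times> bool" and ?c = "(1, True) :: nat \<times> bool"
    and ?s = "(2, True) :: nat \<times> bool" and ?d = "(3, True) :: nat \<times> bool"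
  define E where "E = {([?s, ?b], [?b, ?s]), ([?s, ?c], [?c, ?c, ?s]),
    ([?d, ?b], [?b, ?d]), ([?d, ?c], [?c, ?c, ?d])}"
  let ?X = "{0, 1, 2, 3} :: nat set"
  have a: "bij_betw (a i) ?W ?W" if "i \<in> ?X" for i
    using that by (auto simp: a_def bij_betw_cancel_Cons
        bij_betw_relabel[OF bij_shift] bij_betw_relabel[OF bij_dilate] bij_betw_relabel[OF bij_dilate'])
  then have f: "f \<in> ?X \<rightarrow> carrier ?Q"
    by (auto simp: f_def BijGroup_def Bij_def cong: bij_betw_cong)
  have eq: "eval_word ?Q f u = eval_word ?Q f v" if "(u, v) \<in> E" for u v
  proof -
    have aW: "a i w \<in> ?W" if "i \<in> ?X" "w \<in> ?W" for i w
      using a[OF that(1)] that(2) by (rule bij_betw_apply)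
    have fX: "f i \<in> carrier ?Q" if "i \<in> ?X" for i
      using f that by auto
    have mult: "f i \<otimes>\<^bsub>?Q\<^esub> f j = restrict (\<lambda>x. a i (a j x)) ?W" if "i \<in> ?X" "j \<in> ?X" for i j
      unfolding f_def by (rule BijGroup_mult_restrict) (use a that in auto)
    have mult3: "f i \<otimes>\<^bsub>?Q\<^esub> restrict (\<lambda>x. a j (a k x)) ?W = restrict (\<lambda>x. a i (a j (a k x))) ?W"
      if "i \<in> ?X" "j \<in> ?X" "k \<in> ?X" for i j k
      unfolding f_def by (rule BijGroup_mult_restrict)
        (use a that bij_betw_trans[OF a[OF that(3)] a[OF that(2)]] in \<open>auto simp: comp_def\<close>)
    have "a 2 (a 0 w) = a 0 (a 2 w)" "a 3 (a 0 w) = a 0 (a 3 w)" for w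
      by (simp_all add: a_def relabel_cancel_Cons bij_is_inj bij_dilate bij_dilate' dilate_origin)
    moreover have "a 2 (a 1 w) = a 1 (a 1 (a 2 w))" "a 3 (a 1 w) = a 1 (a 1 (a 3 w))" for w
      by (simp_all add: a_def relabel_comp dilate_shift dilate'_shift del: shift_shift)
    ultimately show ?thesis
      using that by (auto simp: E_def fX mult mult3)
  qed
  have E: "finite E" "E \<subseteq> carrier (free_group ?X) \<times> carrier (free_group ?X)"
    by (simp_all add: E_def carrier_free_group reduced_word_def inv_letter_def)
  have "finite ?X" by simp
  from presented_group_of_equations[OF this E group_BijGroup f eq]
  obtain K :: "nat word set monoid" and g \<psi> where K: "finitely_presented K" and g: "g \<in> ?X \<rightarrow> carrier K"
    and rel: "\<And>u v. (u, v) \<in> E \<Longrightarrow> eval_word K g u = eval_word K g v"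
    and \<psi>: "\<psi> \<in> hom K ?Q" "\<And>x. x \<in> ?X \<Longrightarrow> \<psi> (g x) = f x"
    by metis
  interpret K: group K using K by (simp add: finitely_presented_def)
  have gX: "g i \<in> carrier K" if "i \<in> ?X" for i
    using g that by auto
  have "dyadic_extension K (g 0) (g 1) (g 2) (g 3) \<psi>"
    using rel[of "[?s, ?b]" "[?b, ?s]"] rel[of "[?s, ?c]" "[?c, ?c, ?s]"]
      rel[of "[?d, ?b]" "[?b, ?d]"] rel[of "[?d, ?c]" "[?c, ?c, ?d]"]
    by unfold_locales (simp_all add: E_def gX \<psi> f_def a_def K.m_assoc)
  with K that show ?thesis by blast
qed

context dyadic_extension
begin

sublocale action: group_action K "reduced_words :: point word set" \<psi>
  using \<psi>_hom is_group
  by (simp add: group_action_def group_hom_def group_hom_axioms_def group_BijGroup)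

lemma \<psi>_closed: "g \<in> carrier K \<Longrightarrow> w \<in> reduced_words \<Longrightarrow> \<psi> g w \<in> reduced_words"
  using action.element_image by blast

lemma shift_closed: "w \<in> reduced_words \<Longrightarrow> relabel (shift k) w \<in> reduced_words"
  using bij_betw_relabel[OF bij_shift] by (rule bij_betw_apply)

lemma \<psi>_inv_eq:
  "g \<in> carrier K \<Longrightarrow> w \<in> reduced_words \<Longrightarrow> \<psi> g w = v \<Longrightarrow> \<psi> (inv g) v = w"
  by (rule action.orbit_sym_aux)

lemma \<psi>_one: "w \<in> reduced_words \<Longrightarrow> \<psi> \<one> w = w"
  using \<psi>_inv_eq[of \<one> w] action.composition_rule[of w \<one> \<one>] \<psi>_closed[of \<one> w]
  by simp

lemma \<psi>_\<gamma>_pow: "w \<in> reduced_words \<Longrightarrow> \<psi> (\<gamma> [^] (k :: int)) w = relabel (shift (- 2 * k)) w"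
proof (induction k arbitrary: w rule: int_induct[where k = 0])
  case base
  then show ?case by (simp add: \<psi>_one relabel_ident)
next
  case (step1 k)
  have "\<gamma> [^] (k + 1) = \<gamma> [^] k \<otimes> \<gamma>"
    by (simp add: int_pow_mult)
  then show ?case
    using step1 by (simp add: action.composition_rule \<psi>_\<gamma> shift_closed relabel_comp algebra_simps)
next
  case (step2 k)
  have "\<gamma> [^] (k - 1) = \<gamma> [^] k \<otimes> inv \<gamma>"
    by (simp add: int_pow_diff)
  moreover have "\<psi> (inv \<gamma>) w = relabel (shift 2) w"
    using step2.prems
    by (intro \<psi>_inv_eq) (auto simp: shift_closed \<psi>_\<gamma> relabel_comp relabel_ident)
  ultimately show ?case
    using step2 by (simp add: action.composition_rule shift_closed relabel_comp algebra_simps)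
qed

lemma \<psi>_conj_pow:
  assumes "w \<in> reduced_words"
  shows "\<psi> (conj_pow K \<beta> \<gamma> i) w = cancel_Cons ((2 * i, 0), True) w"
proof -
  have "cancel_Cons ((0, 0), True) (relabel (shift (- (2 * i))) w) \<in> reduced_words"
    using shift_closed[OF assms] bij_betw_cancel_Cons by (metis bij_betw_apply)
  then show ?thesis
    using assms
    by (simp add: conj_pow_def action.composition_rule \<psi>_\<gamma>_pow \<psi>_\<beta> shift_closed
        relabel_cancel_Cons bij_is_inj[OF bij_shift] relabel_comp relabel_ident)
       (simp add: shift_def)
qed

text \<open>
  A product of conjugates of \<open>\<beta>\<close> and their inverses, written as a reduced word in the index, sends the
  empty word to this very word. Hence such a product can be recovered from its action.
\<close>

lemma \<psi>_eval_word_Nil: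
  assumes "reduced_word u"
  shows "\<psi> (eval_word K (conj_pow K \<beta> \<gamma>) u) [] = relabel (\<lambda>i. (2 * i, 0)) u"
  using assms
proof (induction u)
  case Nil
  then show ?case by (simp add: \<psi>_one carrier_free_group)
next
  case (Cons l u)
  let ?f = "\<lambda>i :: int. (2 * i, 0 :: nat)"
  let ?b = "conj_pow K \<beta> \<gamma> (fst l)"
  have inj: "inj ?f" by (auto intro: injI)
  have u: "reduced_word u" using Cons.prems by (rule reduced_word_ConsD)
  then have ru: "relabel ?f u \<in> reduced_words"
    by (simp add: carrier_free_group reduced_word_relabel[OF inj])
  have e: "eval_word K (conj_pow K \<beta> \<gamma>) u \<in> carrier K"
    by (rule eval_word_closed[where X = UNIV]) auto
  have step: "\<psi> (eval_letter K (conj_pow K \<beta> \<gamma>) l) w = cancel_Cons (?f (fst l), snd l) w"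
    if w: "w \<in> reduced_words" for w
  proof (cases "snd l")
    case True
    then show ?thesis using \<psi>_conj_pow[OF w] by (simp add: eval_letter_def)
  next
    case False
    let ?l = "(?f (fst l), True)"
    have "cancel_Cons (inv_letter ?l) w \<in> reduced_words"
      using w bij_betw_cancel_Cons by (metis bij_betw_apply)
    then have "\<psi> (inv ?b) w = cancel_Cons (inv_letter ?l) w"
      using w cancel_Cons_inv[of w ?l] by (intro \<psi>_inv_eq) (auto simp: \<psi>_conj_pow carrier_free_group)
    then show ?thesis using False by (simp add: eval_letter_def inv_letter_def)
  qed
  have "reduced_word ((?f (fst l), snd l) # relabel ?f u)"
    using Cons.prems reduced_word_relabel[OF inj, of "l # u"] by simp
  moreover have "eval_letter K (conj_pow K \<beta> \<gamma>) l \<in> carrier K"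
    by (rule eval_letter_closed[where X = UNIV]) auto
  ultimately show ?case
    using Cons.IH[OF u] step[OF ru] e
    by (simp add: action.composition_rule carrier_free_group cancel_Cons_reduced)
qed

text \<open>
  The finitely generated subgroup that cuts out the conjugates with index \<open>i \<ge> 0\<close>.
\<close>

definition half_line_group where "half_line_group = generate K {\<beta>, \<sigma>, inv \<gamma> \<otimes> \<delta>}"

lemma subgroup_half_line_group: "subgroup half_line_group K"
  unfolding half_line_group_def by (rule generate_is_subgroup) auto

lemma conj_pow_in_half_line_group: "0 \<le> i \<Longrightarrow> conj_pow K \<beta> \<gamma> i \<in> half_line_group"
  by (rule half_line_in_subgroup[OF subgroup_half_line_group, of \<beta> \<sigma> \<gamma> \<delta>])
    (auto simp: half_line_group_def rel_\<sigma> rel_\<delta> intro: generate.incl)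

text \<open>
  This invariant keeps the conjugates with negative index out of the subgroup: such a conjugate
  multiplies by a letter outside the half plane.
\<close>

lemma half_line_group_preserves_half_plane:
  assumes "g \<in> half_line_group" "w \<in> reduced_words"
  shows "\<psi> g w \<in> carrier (free_group half_plane) \<longleftrightarrow> w \<in> carrier (free_group half_plane)"
    (is "_ \<in> ?Y \<longleftrightarrow> _")
proof -
  have gens: "\<psi> h v \<in> ?Y \<longleftrightarrow> v \<in> ?Y" if h: "h \<in> {\<beta>, \<sigma>, inv \<gamma> \<otimes> \<delta>}" and v: "v \<in> reduced_words" for h v
  proof -
    have "\<psi> \<beta> v \<in> ?Y \<longleftrightarrow> v \<in> ?Y"
      unfolding \<psi>_\<beta>[OF v] by (rule cancel_Cons_in_free_group)
        (use v in \<open>auto simp: carrier_free_group half_plane_def\<close>)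
    moreover have "\<psi> \<sigma> v \<in> ?Y \<longleftrightarrow> v \<in> ?Y"
      by (simp add: \<psi>_\<sigma>[OF v] half_plane_relabel bij_dilate dilate_half_plane)
    moreover have "\<psi> (inv \<gamma> \<otimes> \<delta>) v \<in> ?Y \<longleftrightarrow> v \<in> ?Y"
    proof -
      have d: "relabel dilate' v \<in> reduced_words"
        using bij_betw_relabel[OF bij_dilate'] v by (rule bij_betw_apply)
      have "\<psi> (inv \<gamma>) (relabel dilate' v) = relabel (shift 2) (relabel dilate' v)"
        using \<psi>_\<gamma>_pow[OF d, of "- 1"] by (simp add: int_pow_neg)
      moreover have "bij (\<lambda>p. shift 2 (dilate' p))"
        using bij_comp[OF bij_dilate' bij_shift[of 2]] by (simp add: comp_def)
      ultimately show ?thesis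
        using v by (simp add: action.composition_rule \<psi>_\<delta> relabel_comp half_plane_relabel
            shift_dilate'_half_plane)
    qed
    ultimately show ?thesis using h by auto
  qed
  note sc = subgroup.mem_carrier[OF subgroup_half_line_group]
  from assms show ?thesis unfolding half_line_group_def
  proof (induction g arbitrary: w rule: generate.induct)
    case one
    then show ?case by (simp add: \<psi>_one)
  next
    case (incl h)
    then show ?case using gens by blast
  next
    case (inv h)
    have h: "h \<in> carrier K" using inv.hyps by auto
    have "\<psi> (inv h) w \<in> reduced_words"
      using \<psi>_closed inv.prems h by auto
    moreover have "\<psi> h (\<psi> (inv h) w) = w"
      using action.composition_rule[of w h "inv h"] inv.prems h by (simp add: \<psi>_one)
    ultimately show ?case using gens[OF inv.hyps] by metis
  next
    case (eng g h)
    have "g \<in> carrier K" "h \<in> carrier K"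
      using eng.hyps sc by (auto simp: half_line_group_def)
    then show ?case
      using eng by (simp add: action.composition_rule \<psi>_closed)
  qed
qed

text \<open>
  Applied to the empty word, the element gives the word \<open>u\<close>, on which the power of \<open>\<gamma>\<close> has no influence;
  invariance of the half plane therefore bounds the indices in \<open>u\<close>. The factor belonging to \<open>u\<close> then lies
  in the subgroup, so the power of \<open>\<gamma>\<close> does too, and a nontrivial translation or its inverse moves the
  origin out of the half plane.
\<close>

lemma normal_form_in_half_line_group:
  assumes u: "reduced_word u"
    and g: "eval_word K (conj_pow K \<beta> \<gamma>) u \<otimes> \<gamma> [^] (k :: int) \<in> half_line_group"
  shows "fst ` set u \<subseteq> {0..}" "k = 0"
proof -
  let ?f = "\<lambda>i :: int. (2 * i, 0 :: nat)"
  let ?Y = "carrier (free_group half_plane)"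
  let ?h = "eval_word K (conj_pow K \<beta> \<gamma>) u"
  have h: "?h \<in> carrier K"
    by (rule eval_word_closed[where X = UNIV]) auto
  have "\<psi> (?h \<otimes> \<gamma> [^] k) [] = relabel ?f u"
    using h \<psi>_eval_word_Nil[OF u] by (simp add: action.composition_rule carrier_free_group \<psi>_\<gamma>_pow)
  then have "relabel ?f u \<in> ?Y"
    using half_line_group_preserves_half_plane[OF g, of "[]"] by (simp add: carrier_free_group)
  then have "?f ` fst ` set u \<subseteq> half_plane"
    by (simp only: carrier_free_group fst_set_relabel)
  then show u0: "fst ` set u \<subseteq> {0..}"
    by (force simp: half_plane_def)
  have "eval_word K (conj_pow K \<beta> \<gamma>) u \<in> generate K (conj_pow K \<beta> \<gamma> ` {0..})"
    using u0 by (rule eval_word_in_generate)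
  moreover have "generate K (conj_pow K \<beta> \<gamma> ` {0..}) \<subseteq> half_line_group"
    using conj_pow_in_half_line_group by (intro generate_subgroup_incl subgroup_half_line_group) auto
  ultimately have "inv ?h \<in> half_line_group"
    by (intro subgroup.m_inv_closed[OF subgroup_half_line_group]) blast
  then have "inv ?h \<otimes> (?h \<otimes> \<gamma> [^] k) \<in> half_line_group"
    using g by (rule subgroup.m_closed[OF subgroup_half_line_group])
  then have \<gamma>k: "\<gamma> [^] k \<in> half_line_group"
    using h by (metis closed(2) int_pow_closed inv_closed l_inv l_one m_assoc)
  then have \<gamma>k': "\<gamma> [^] (- k) \<in> half_line_group"
    using subgroup_half_line_group by (simp add: int_pow_neg subgroup.m_inv_closed)
  have "l \<le> 0" if "\<gamma> [^] l \<in> half_line_group" for l :: int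
  proof -
    have "[((0, 0), True)] \<in> ?Y" by (simp add: half_plane_def)
    then have "[((- 2 * l, 0), True)] \<in> ?Y"
      using half_line_group_preserves_half_plane[OF that, of "[((0, 0), True)]"] by (simp add: \<psi>_\<gamma>_pow shift_def)
    then show ?thesis by (simp add: half_plane_def)
  qed
  from this[OF \<gamma>k] this[OF \<gamma>k'] show "k = 0" by simp
qed

text \<open>
  A homomorphism from a free group on \<open>b\<close> and \<open>c\<close> that sends them to \<open>\<beta>\<close> and \<open>\<gamma>\<close> is injective by
  this, since every element of that group has the corresponding form.
\<close>

lemma normal_form_eq_one:
  assumes u: "reduced_word u"
    and g: "eval_word K (conj_pow K \<beta> \<gamma>) u \<otimes> \<gamma> [^] (k :: int) = \<one>"
  shows "u = []" "k = 0"
proof -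
  show k: "k = 0"
    using normal_form_in_half_line_group(2)[OF u] g subgroup.one_closed[OF subgroup_half_line_group] by simp
  have "eval_word K (conj_pow K \<beta> \<gamma>) u \<in> carrier K"
    by (rule eval_word_closed[where X = UNIV]) auto
  then have "[] = relabel (\<lambda>i :: int. (2 * i, 0 :: nat)) u"
    using \<psi>_eval_word_Nil[OF u] g k by (simp add: \<psi>_one carrier_free_group)
  then show "u = []" by (simp add: relabel_def)
qed

end


section \<open>Benign half-lines of conjugates\<close>

text \<open>
  Freeness is expressed by the universal property alone, in the one type of groups that occurs.
  In this form it passes to other pairs of generators without any manipulation of words.
\<close>

lemma benign_nonneg_conjugates:
  fixes F :: "('a, 'm) monoid_scheme"
  assumes F: "group F" and bc: "b \<in> carrier F" "c \<in> carrier F"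
    and gen: "generate F {b, c} = carrier F"
    and free: "\<And>(K :: nat word set monoid) \<beta> \<gamma>. group K \<Longrightarrow> \<beta> \<in> carrier K \<Longrightarrow> \<gamma> \<in> carrier K \<Longrightarrow>
      \<exists>\<phi> \<in> hom F K. \<phi> b = \<beta> \<and> \<phi> c = \<gamma>"
  shows "benign (generate F (conj_pow F b c ` {0..})) F"
proof -
  interpret F: group F by (rule F)
  obtain K :: "nat word set monoid" and \<beta> \<gamma> \<sigma> \<delta> \<psi>
    where fp: "finitely_presented K" and "dyadic_extension K \<beta> \<gamma> \<sigma> \<delta> \<psi>"
    by (rule dyadic_extension_exists)
  then interpret K: dyadic_extension K \<beta> \<gamma> \<sigma> \<delta> \<psi> by simp
  obtain \<phi> where \<phi>: "\<phi> \<in> hom F K" "\<phi> b = \<beta>" "\<phi> c = \<gamma>"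
    using free[OF K.is_group K.closed(1,2)] by blast
  interpret \<phi>: group_hom F K \<phi>
    using \<phi> by (simp add: group_hom_def group_hom_axioms_def)
  let ?H = "generate F (conj_pow F b c ` {0..})" and ?L = "K.half_line_group"
  have \<phi>_conj: "\<phi> (conj_pow F b c i) = conj_pow K \<beta> \<gamma> i" for i
    using \<phi>.hom_conj_pow[OF bc] \<phi> by simp
  have \<phi>_eval: "\<phi> (eval_word F (conj_pow F b c) u) = eval_word K (conj_pow K \<beta> \<gamma>) u" for u
  proof (induction u)
    case (Cons l u)
    have "eval_letter F (conj_pow F b c) l \<in> carrier F" "eval_word F (conj_pow F b c) u \<in> carrier F"
      using bc by (auto intro!: F.eval_letter_closed[where X = UNIV] F.eval_word_closed[where X = UNIV])
    moreover have "\<phi> (eval_letter F (conj_pow F b c) l) = eval_letter K (conj_pow K \<beta> \<gamma>) l"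
      using bc by (simp add: eval_letter_def \<phi>_conj)
    ultimately show ?case using Cons by simp
  qed simp
  have normal_form: "\<exists>u k. reduced_word u \<and> g = eval_word F (conj_pow F b c) u \<otimes>\<^bsub>F\<^esub> c [^]\<^bsub>F\<^esub> (k :: int)
      \<and> \<phi> g = eval_word K (conj_pow K \<beta> \<gamma>) u \<otimes>\<^bsub>K\<^esub> \<gamma> [^]\<^bsub>K\<^esub> k" if "g \<in> carrier F" for g
  proof -
    obtain h and k :: int where h: "h \<in> generate F (range (conj_pow F b c))" "g = h \<otimes>\<^bsub>F\<^esub> c [^]\<^bsub>F\<^esub> k"
      using F.generate_pair_normal_form[OF bc] gen \<open>g \<in> carrier F\<close> by metis
    obtain u where u: "reduced_word u" "h = eval_word F (conj_pow F b c) u"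
    proof (rule F.generate_range_eval_word[OF _ h(1)])
      show "range (conj_pow F b c) \<subseteq> carrier F" using bc by auto
    qed
    then have "h \<in> carrier F"
      using bc by (auto intro!: F.eval_word_closed[where X = UNIV])
    then show ?thesis
      using h(2) u bc \<phi> by (intro exI[of _ u] exI[of _ k]) (simp add: \<phi>_eval[symmetric] \<phi>.hom_int_pow)
  qed
  have H: "subgroup ?H F"
    by (rule F.generate_is_subgroup) (use bc in auto)
  have "finitely_generated F"
    unfolding finitely_generated_def using F gen bc by (intro conjI exI[where x = "{b, c}"]) auto
  moreover have "\<phi> \<in> mon F K"
  proof -
    have "g = \<one>\<^bsub>F\<^esub>" if "g \<in> carrier F" "\<phi> g = \<one>\<^bsub>K\<^esub>" for g
      using normal_form[OF that(1)] K.normal_form_eq_one that(2) by fastforce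
    then show ?thesis
      using \<phi>(1) by (simp add: mon_iff_hom_one[OF F K.is_group])
  qed
  moreover have "finitely_generated (K\<lparr>carrier := ?L\<rparr>)"
  proof -
    let ?S = "{\<beta>, \<sigma>, inv\<^bsub>K\<^esub> \<gamma> \<otimes>\<^bsub>K\<^esub> \<delta>}"
    have "finite ?S" "?S \<subseteq> carrier K" "generate K ?S = ?L"
      by (simp_all add: K.half_line_group_def)
    then show ?thesis
      unfolding finitely_generated_subgroup_iff[OF K.is_group K.subgroup_half_line_group] by blast
  qed
  moreover have "\<phi> ` carrier F \<inter> ?L = \<phi> ` ?H"
  proof
    show "\<phi> ` carrier F \<inter> ?L \<subseteq> \<phi> ` ?H"
    proof clarify
      fix g assume g: "g \<in> carrier F" "\<phi> g \<in> ?L"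
      then obtain u and k :: int where u: "reduced_word u"
        "g = eval_word F (conj_pow F b c) u \<otimes>\<^bsub>F\<^esub> c [^]\<^bsub>F\<^esub> k"
        "\<phi> g = eval_word K (conj_pow K \<beta> \<gamma>) u \<otimes>\<^bsub>K\<^esub> \<gamma> [^]\<^bsub>K\<^esub> k"
        using normal_form by blast
      with g have "fst ` set u \<subseteq> {0..}" "k = 0"
        using K.normal_form_in_half_line_group[OF u(1), of k] by auto
      moreover from this have "eval_word F (conj_pow F b c) u \<in> ?H"
        by (intro eval_word_in_generate)
      ultimately have "g \<in> ?H"
        using u(2) subgroup.mem_carrier[OF H] by simp
      then show "\<phi> g \<in> \<phi> ` ?H" by blast
    qed
    have "\<phi> ` ?H = generate K (\<phi> ` conj_pow F b c ` {0..})"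
      by (rule \<phi>.generate_img[symmetric]) (use bc in auto)
    also have "\<dots> \<subseteq> ?L"
      using K.conj_pow_in_half_line_group
      by (intro K.generate_subgroup_incl K.subgroup_half_line_group) (auto simp: \<phi>_conj)
    finally show "\<phi> ` ?H \<subseteq> \<phi> ` carrier F \<inter> ?L"
      using subgroup.subset[OF H] by blast
  qed
  ultimately show ?thesis
    using benignI[OF _ H fp _ K.subgroup_half_line_group] by blast
qed

theorem corollary5p3:
  fixes F :: "('a, 'm) monoid_scheme" and b c :: 'a and m :: int
  assumes "free_on F {b, c}" and "b \<noteq> c"
  shows "benign (generate F (conj_pow F b c ` {m..})) F \<and>
         benign (generate F (conj_pow F b c ` {..m - 1})) F"
proof -
  have F: "group F" and bc: "b \<in> carrier F" "c \<in> carrier F"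
    using assms(1) by (auto simp: free_on_def)
  interpret F: group F by (rule F)
  have gen: "generate F {b, c} = carrier F"
    using assms(1) by (rule free_on_imp_generate)
  \<comment> \<open>The pairs \<open>c\<^sup>-\<^sup>n b c\<^sup>n\<close>, \<open>c\<close> and \<open>c\<^sup>-\<^sup>n b c\<^sup>n\<close>, \<open>c\<inverse>\<close> are again free generators. Passing to them
    shifts the index, or shifts and reverses it, which turns both half-lines into the nonnegative one.\<close>
  have basis: "benign (generate F (conj_pow F (conj_pow F b c n) d ` {0..})) F"
    if d: "d = c \<or> d = inv\<^bsub>F\<^esub> c" for d and n :: int
  proof (rule benign_nonneg_conjugates[OF F])
    let ?b = "conj_pow F b c n"
    have d': "d \<in> carrier F" and dc: "c = d \<or> c = inv\<^bsub>F\<^esub> d"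
      using d bc by auto
    show "?b \<in> carrier F" "d \<in> carrier F"
      using bc d' by auto
    let ?S = "generate F {?b, d}"
    have S: "subgroup ?S F"
      by (rule F.generate_is_subgroup) (use bc d' in auto)
    have "c \<in> ?S"
      using dc by (auto intro: generate.incl generate.inv)
    then have "conj_pow F ?b c (- n) \<in> ?S"
      unfolding conj_pow_def[of F ?b]
      by (intro subgroup.m_closed[OF S] F.subgroup_int_pow_closed[OF S]) (auto intro: generate.incl)
    with bc have "b \<in> ?S"
      by (simp add: F.conj_pow_conj_pow)
    with \<open>c \<in> ?S\<close> have "generate F {b, c} \<subseteq> ?S"
      by (intro F.generate_subgroup_incl S) auto
    with gen show "?S = carrier F"
      using subgroup.subset[OF S] by auto
    fix K :: "nat word set monoid" and \<beta> \<gamma>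
    assume K: "group K" "\<beta> \<in> carrier K" "\<gamma> \<in> carrier K"
    interpret K: group K by (rule K)
    \<comment> \<open>The images of \<open>b\<close> and \<open>c\<close> are found by solving for them in terms of the new generators.\<close>
    define \<gamma>' where "\<gamma>' = (if d = c then \<gamma> else inv\<^bsub>K\<^esub> \<gamma>)"
    have \<gamma>': "\<gamma>' \<in> carrier K" using K by (simp add: \<gamma>'_def)
    obtain \<phi> where \<phi>: "\<phi> \<in> hom F K" "\<phi> b = conj_pow K \<beta> \<gamma>' (- n)" "\<phi> c = \<gamma>'"
      using free_on_imp_universal[OF assms K(1) K.conj_pow_closed[OF K(2) \<gamma>'] \<gamma>'] by blast
    interpret \<phi>: group_hom F K \<phi>
      using \<phi> K F by (simp add: group_hom_def group_hom_axioms_def)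
    have "\<phi> ?b = \<beta>"
      using K \<gamma>' bc \<phi> by (simp add: \<phi>.hom_conj_pow K.conj_pow_conj_pow)
    moreover have "\<phi> d = \<gamma>"
      using d bc \<phi>(3) K by (cases "d = c") (simp_all add: \<gamma>'_def)
    ultimately show "\<exists>\<phi> \<in> hom F K. \<phi> ?b = \<beta> \<and> \<phi> d = \<gamma>"
      using \<phi> by blast
  qed
  have "conj_pow F (conj_pow F b c m) c ` {0..} = conj_pow F b c ` {m..}"
  proof -
    have "{m..} = (+) m ` {0..}" by (simp add: image_add_atLeast)
    then show ?thesis
      using bc by (simp only: image_image) (intro image_cong refl F.conj_pow_conj_pow)
  qed
  moreover have "conj_pow F (conj_pow F b c (m - 1)) (inv\<^bsub>F\<^esub> c) ` {0..} = conj_pow F b c ` {..m - 1}"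
  proof -
    have "{..m - 1} = (\<lambda>i. m - 1 + - i) ` {0..}"
    proof
      show "{..m - 1} \<subseteq> (\<lambda>i. m - 1 + - i) ` {0..}"
      proof
        fix j assume "j \<in> {..m - 1}"
        then have "j = m - 1 + - (m - 1 - j)" "m - 1 - j \<in> {0..}" by auto
        then show "j \<in> (\<lambda>i. m - 1 + - i) ` {0..}" by (rule image_eqI)
      qed
    qed auto
    then show ?thesis
      using bc by (simp only: image_image)
        (intro image_cong refl, simp add: F.conj_pow_inv F.conj_pow_conj_pow del: add_uminus_conv_diff)
  qed
  ultimately show ?thesis
    using basis[of c m] basis[of "inv\<^bsub>F\<^esub> c" "m - 1"] by simp
qed

end
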